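(* Consider the $M$-group Curie-Weiss model with homogeneous coupling matrix, all of whose entries equal a constant $\beta\ge0$. Then, for every $\beta\geq 0$ (i.e. in all regimes), $$\left(\frac{S_1}{N_1},\ldots,\frac{S_M}{N_M}\right)\Longrightarrow\frac12\left(\delta_{(-m(\beta),\ldots,-m(\beta))}+\delta_{(m(\beta),\ldots,m(\beta))}\right)\quad\text{as }N\to\infty,$$ where $m(\beta)=0$ if $\beta\le1$, and for $\beta>1$, $m(\beta)$ is the unique strictly positive solution $t$ of $\tanh(\beta t)=t$.
   Context: Setting. Fix $M\in\mathbb{N}$. For each $N$ there are group sizes $N_1,\ldots,N_M\in\mathbb{N}$ with $\sum_\lambda N_\lambda=N$, and as $N\to\infty$ each $N_\lambda\to\infty$ and $N_\lambda/N\to\alpha_\lambda$, where $\alpha_\lambda\ge 0$ (possibly $0$) and $\sum_\lambda\alpha_\lambda=1$. For a fixed positive semi-definite real symmetric $M\times M$ coupling matrix $J=(J_{\lambda\mu})$, the $M$-group Curie-Weiss model is the collection of $\{-1,1\}$-valued random variables $X_{\lambda i}$ ($1\le\lambda\le M$, $1\le i\le N_\lambda$) with $$\mathbb{P}(X_{11}=x_{11},\ldots,X_{MN_M}=x_{MN_M})=Z^{-1}\exp\Big(\frac{1}{2N}\sum_{\lambda,\mu=1}^M J_{\lambda\mu}\sum_{i=1}^{N_\lambda}\sum_{j=1}^{N_\mu}x_{\lambda i}x_{\mu j}\Big),$$ $Z$ being the normalising constant. Put $S_\lambda=\sum_{i=1}^{N_\lambda}X_{\lambda i}$. $J$ is homogeneous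 if $J_{\lambda\mu}=\beta$ for all $\lambda,\mu$. $\delta_x$ is the Dirac measure at $x\in\mathbb{R}^M$; $\Longrightarrow$ denotes weak convergence of the distributions. *)

theory Defs
  imports "HOL-Probability.Probability"
begin


definition psd_matrix :: "real ^ 'm ^ 'm \<Rightarrow> bool" where
  "psd_matrix J \<longleftrightarrow> transpose J = J \<and> (\<forall>v. 0 \<le> v \<bullet> (J *v v))"

definition homogeneous_coupling :: "real ^ 'm ^ 'm \<Rightarrow> real \<Rightarrow> bool" where
  "homogeneous_coupling J \<beta> \<longleftrightarrow> (\<forall>\<kappa> \<mu>. J $ \<kappa> $ \<mu> = \<beta>)"

text \<open>The groups are the elements of the finite type \<open>'m\<close>, and \<open>n \<kappa>\<close> is the size
  of group \<open>\<kappa>\<close>. Spin configurations are extensional (\<open>undefined\<close> outside the index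
  set), so that there are exactly two to the power of the number of spins of them.\<close>

definition spin_configs :: "('m::finite \<Rightarrow> nat) \<Rightarrow> ('m \<Rightarrow> nat \<Rightarrow> real) set" where
  "spin_configs n = (\<Pi>\<^sub>E \<kappa>\<in>UNIV. \<Pi>\<^sub>E i\<in>{1..n \<kappa>}. {-1, 1})"

definition gibbs_weight ::
  "real ^ 'm ^ 'm \<Rightarrow> ('m::finite \<Rightarrow> nat) \<Rightarrow> ('m \<Rightarrow> nat \<Rightarrow> real) \<Rightarrow> real" where
  "gibbs_weight J n x =
     exp (1 / (2 * real (\<Sum>\<kappa>\<in>UNIV. n \<kappa>)) *
       (\<Sum>\<kappa>\<in>UNIV. \<Sum>\<mu>\<in>UNIV. J $ \<kappa> $ \<mu> * (\<Sum>i=1..n \<kappa>. \<Sum>j=1..n \<mu>. x \<kappa> i * x \<mu> j)))"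

definition partition_function :: "real ^ 'm ^ 'm \<Rightarrow> ('m::finite \<Rightarrow> nat) \<Rightarrow> real" where
  "partition_function J n = (\<Sum>x\<in>spin_configs n. gibbs_weight J n x)"

text \<open>Only the variables \<open>X \<kappa> i\<close> with \<open>1 \<le> i \<le> n \<kappa>\<close> belong to the model.\<close>

locale curie_weiss = prob_space P
  for P :: "'a measure" and J :: "real ^ 'm::finite ^ 'm" and n :: "'m \<Rightarrow> nat"
    and X :: "'m \<Rightarrow> nat \<Rightarrow> 'a \<Rightarrow> real" +
  assumes coupling_psd: "psd_matrix J"
    and spin_measurable: "\<And>\<kappa> i. i \<in> {1..n \<kappa>} \<Longrightarrow> X \<kappa> i \<in> borel_measurable P"
    and spin_values: "\<And>\<kappa> i \<omega>. i \<in> {1..n \<kappa>} \<Longrightarrow> \<omega> \<in> space P \<Longrightarrow> X \<kappa> i \<omega> \<in> {-1, 1}"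
    and joint_law: "\<And>x. x \<in> spin_configs n \<Longrightarrow>
          measure P {\<omega> \<in> space P. \<forall>\<kappa>. \<forall>i\<in>{1..n \<kappa>}. X \<kappa> i \<omega> = x \<kappa> i}
            = gibbs_weight J n x / partition_function J n"

definition group_means ::
  "('m::finite \<Rightarrow> nat) \<Rightarrow> ('m \<Rightarrow> nat \<Rightarrow> 'a \<Rightarrow> real) \<Rightarrow> 'a \<Rightarrow> real ^ 'm" where
  "group_means n X \<omega> = (\<chi> \<kappa>. (\<Sum>i=1..n \<kappa>. X \<kappa> i \<omega>) / real (n \<kappa>))"

text \<open>The library's \<open>weak_conv_m\<close> covers only measures on the real line.\<close>

definition weakly_converges ::
  "(nat \<Rightarrow> 'b::topological_space measure) \<Rightarrow> 'b measure \<Rightarrow> bool" where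
  "weakly_converges \<mu> \<nu> \<longleftrightarrow>
     (\<forall>f :: 'b \<Rightarrow> real. continuous_on UNIV f \<longrightarrow> bounded (range f) \<longrightarrow>
        (\<lambda>N. \<integral>x. f x \<partial>\<mu> N) \<longlonglongrightarrow> (\<integral>x. f x \<partial>\<nu>))"

definition two_point_measure :: "'b::topological_space \<Rightarrow> 'b \<Rightarrow> 'b measure" where
  "two_point_measure x y = measure_of UNIV (sets borel)
     (\<lambda>A. 1/2 * (emeasure (return borel x) A + emeasure (return borel y) A))"

lemma sets_two_point_measure [simp, measurable_cong]: "sets (two_point_measure x y) = sets borel"
  unfolding two_point_measure_def
  using sets.sigma_sets_eq[of borel] by (simp add: sets_measure_of_conv)

lemma space_two_point_measure [simp]: "space (two_point_measure x y) = UNIV"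
  unfolding two_point_measure_def by (simp add: space_measure_of_conv)

text \<open>\<open>measure_of\<close> is the zero measure when its argument is not countably additive;
  the following lemma excludes this.\<close>

lemma emeasure_two_point_measure:
  assumes "A \<in> sets borel"
  shows "emeasure (two_point_measure x y) A
    = 1/2 * (emeasure (return borel x) A + emeasure (return borel y) A)"
proof (rule emeasure_measure_of[OF two_point_measure_def])
  show "sets borel \<subseteq> Pow (UNIV :: 'a set)"
    by simp
  show "A \<in> sets (two_point_measure x y)"
    using assms by simp
  show "positive (sets (two_point_measure x y))
     (\<lambda>A. 1/2 * (emeasure (return borel x) A + emeasure (return borel y) A))"
    by (simp add: positive_def)
  show "countably_additive (sets (two_point_measure x y))
     (\<lambda>A. 1/2 * (emeasure (return borel x) A + emeasure (return borel y) A))"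
  proof (rule countably_additiveI)
    fix B :: "nat \<Rightarrow> 'a set"
    assume B: "range B \<subseteq> sets (two_point_measure x y)" "disjoint_family B"
    have "(\<Sum>i. emeasure (return borel z) (B i)) = emeasure (return borel z) (\<Union>i. B i)" for z
      using B by (intro suminf_emeasure) auto
    then show "(\<Sum>i. 1/2 * (emeasure (return borel x) (B i) + emeasure (return borel y) (B i)))
       = 1/2 * (emeasure (return borel x) (\<Union>i. B i) + emeasure (return borel y) (\<Union>i. B i))"
      by (simp add: suminf_add[symmetric])
  qed
qed

definition magnetization :: "real \<Rightarrow> real" where
  "magnetization \<beta> = (if \<beta> \<le> 1 then 0 else (THE t. 0 < t \<and> tanh (\<beta> * t) = t))"

lemma magnetization_ex1:
  fixes \<beta> :: real
  assumes "1 < \<beta>"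
  shows "\<exists>!t. 0 < t \<and> tanh (\<beta> * t) = t"
proof -
  define g where "g = (\<lambda>t::real. tanh (\<beta> * t) - t)"
  define g' where "g' = (\<lambda>t::real. \<beta> * (1 - tanh (\<beta> * t) ^ 2) - 1)"
  have der: "(g has_real_derivative g' t) (at t)" for t
    unfolding g_def g'_def by (auto intro!: derivative_eq_intros)
  have cont: "continuous_on S g" for S
    using der by (meson DERIV_continuous continuous_at_imp_continuous_on)
  have "g' 0 > 0"
    using assms by (simp add: g'_def)
  then obtain d where d: "d > 0" "\<And>h. 0 < h \<Longrightarrow> h < d \<Longrightarrow> g 0 < g (0 + h)"
    using DERIV_pos_inc_right[OF der] by blast
  define e where "e = min (d / 2) (1 / 2)"
  have e: "0 < e" "e < d" "e < 1"
    using d(1) by (auto simp: e_def)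
  have "0 \<le> g e"
    using d(2)[of e] e by (simp add: g_def)
  moreover have "g 1 \<le> 0"
    using tanh_real_lt_1[of \<beta>] by (simp add: g_def)
  ultimately obtain t where "e \<le> t" "g t = 0"
    using IVT2'[of g 1 0 e] e cont by auto
  then have ex: "0 < t \<and> tanh (\<beta> * t) = t"
    using e by (simp add: g_def)
  have no_two: False if st: "0 < s" "s < t" "g s = 0" "g t = 0" for s t
  proof -
    have zero: "\<exists>z. a < z \<and> z < b \<and> g' z = 0" if "a < b" "g a = g b" for a b
      using that cont MVT2[of a b g g'] der by fastforce
    have "g 0 = 0"
      by (simp add: g_def)
    then obtain u v where u: "0 < u" "u < s" "g' u = 0" and v: "s < v" "v < t" "g' v = 0"
      using zero[of 0 s] zero[of s t] st by auto
    have "\<beta> * (1 - tanh (\<beta> * u) ^ 2) = \<beta> * (1 - tanh (\<beta> * v) ^ 2)"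
      using u(3) v(3) by (simp add: g'_def)
    then have "tanh (\<beta> * u) ^ 2 = tanh (\<beta> * v) ^ 2"
      using assms by simp
    moreover have "0 \<le> tanh (\<beta> * u)" "0 \<le> tanh (\<beta> * v)"
      using u v assms by auto
    ultimately have "tanh (\<beta> * u) = tanh (\<beta> * v)"
      by (simp add: power2_eq_iff_nonneg)
    then show False
      using u v assms by simp
  qed
  show ?thesis
  proof (rule ex1I[where a = t], rule ex)
    fix s assume "0 < s \<and> tanh (\<beta> * s) = s"
    then show "s = t"
      using no_two[of s t] no_two[of t s] ex by (cases s t rule: linorder_cases) (auto simp: g_def)
  qed
qed

end

theory Submission
  imports Defs "HOL-Real_Asymp.Real_Asymp"
begin

text \<open>The spins are exchangeable, so each group mean differs from the overall mean \<open>S / N\<close> by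
  \<open>O(1 / sqrt (n \<kappa>))\<close> in mean square: it suffices to locate \<open>S / N\<close>. Its law gives the value
  \<open>(2 k - N) / N\<close> a mass proportional to \<open>(N choose k) exp (\<beta> (2 k - N)\<^sup>2 / (2 N))\<close>, and the
  quotient of consecutive masses near \<open>t \<ge> 0\<close> is about \<open>(1 - t) / (1 + t) exp (2 \<beta> t)\<close>, which
  exceeds \<open>1\<close> iff \<open>t < tanh (\<beta> t)\<close>, that is, iff \<open>0 < t < m(\<beta>)\<close>, and is below \<open>1\<close> for
  \<open>t > m(\<beta>)\<close>. Hence the masses decay geometrically away from \<open>\<plusminus> m(\<beta>)\<close>, and the spin flip symmetry
  splits the limit evenly between the two points.\<close>

subsection \<open>Exchangeability\<close>

text \<open>A configuration is stored as its set \<open>A\<close> of plus sites. A weight that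
  depends only on the total spin is then a function of \<open>card A\<close>.\<close>

definition spin :: "'i set \<Rightarrow> 'i \<Rightarrow> real" where
  "spin A p = (if p \<in> A then 1 else -1)"

lemma spin_square [simp]: "spin A p * spin A p = 1"
  by (simp add: spin_def)

lemma abs_spin [simp]: "\<bar>spin A p\<bar> = 1"
  by (simp add: spin_def)

lemma sum_spin:
  assumes "finite I" "A \<subseteq> I"
  shows "(\<Sum>p\<in>I. spin A p) = 2 * real (card A) - real (card I)"
proof -
  have "(\<Sum>p\<in>I. spin A p) = (\<Sum>p\<in>I. 2 * indicator A p - 1)"
    by (intro sum.cong) (auto simp: spin_def indicator_def)
  also have "\<dots> = 2 * (\<Sum>p\<in>I. indicator A p) - real (card I)"
    by (simp add: sum_subtractf sum_distrib_left)
  also have "(\<Sum>p\<in>I. indicator A p :: real) = real (card A)"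
    using assms by (simp add: indicator_def Int_absorb1 flip: Int_def)
  finally show ?thesis .
qed

text \<open>Reindexing by the transposition of \<open>q\<close> and \<open>r\<close> permutes the
  subsets of \<open>I\<close> and keeps cardinalities; \<open>p\<close> differs from both, so its
  spin is untouched.\<close>

lemma sum_symmetric_spin_pair_swap:
  fixes g :: "nat \<Rightarrow> real"
  assumes "q \<in> I" "r \<in> I" "p \<noteq> q" "p \<noteq> r"
  shows "(\<Sum>A\<in>Pow I. g (card A) * (spin A p * spin A q))
       = (\<Sum>A\<in>Pow I. g (card A) * (spin A p * spin A r))"
proof -
  let ?\<tau> = "Transposition.transpose q r"
  have inv: "?\<tau> ` ?\<tau> ` A = A" for A
    by (simp add: image_comp)
  have sub: "?\<tau> ` A \<subseteq> I" if "A \<subseteq> I" for A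
    using that assms by (auto simp: Transposition.transpose_def)
  have card: "card (?\<tau> ` A) = card A" for A
    by (intro card_image inj_on_subset[OF inj_transpose]) auto
  have mem: "x \<in> ?\<tau> ` A \<longleftrightarrow> ?\<tau> x \<in> A" for x A
    by (metis imageE image_eqI transpose_involutory)
  have "spin (?\<tau> ` A) p = spin A p" "spin (?\<tau> ` A) r = spin A q" for A
    using assms by (auto simp: spin_def mem)
  then show ?thesis
    using inv sub card
    by (intro sum.reindex_bij_witness[of _ "image ?\<tau>" "image ?\<tau>"]) auto
qed

text \<open>By symmetry all off-diagonal correlations share one value \<open>a\<close>, and the
  diagonal ones equal \<open>Z\<close>. Expanding the square leaves exactly
  \<open>(Z - a) * (1 / n - 1 / N)\<close> with \<open>|a| \<le> Z\<close>, so the bound holds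
  however strongly the spins are correlated.\<close>

lemma symmetric_group_mean_deviation:
  fixes g :: "nat \<Rightarrow> real"
  assumes fin: "finite I" and G: "G \<subseteq> I" "G \<noteq> {}" and g: "\<And>k. 0 \<le> g k"
  shows "(\<Sum>A\<in>Pow I. g (card A) * ((\<Sum>p\<in>G. spin A p) / card G - (\<Sum>p\<in>I. spin A p) / card I)\<^sup>2)
       \<le> 2 / card G * (\<Sum>A\<in>Pow I. g (card A))"
proof -
  define c where "c p q = (\<Sum>A\<in>Pow I. g (card A) * (spin A p * spin A q))" for p q
  define Z where "Z = (\<Sum>A\<in>Pow I. g (card A))"
  have Z0: "0 \<le> Z"
    unfolding Z_def by (intro sum_nonneg g)
  have diag: "c p p = Z" for p
    by (simp add: c_def Z_def)
  have sym: "c p q = c q p" for p q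
    by (simp add: c_def mult.commute)
  have abs_c: "\<bar>c p q\<bar> \<le> Z" for p q
    unfolding c_def Z_def
    by (rule sum_abs[THEN order_trans]) (simp add: abs_mult g)
  have swap: "c p q = c p r" if "q \<in> I" "r \<in> I" "p \<noteq> q" "p \<noteq> r" for p q r
    unfolding c_def using that by (rule sum_symmetric_spin_pair_swap)
  obtain a where a: "\<bar>a\<bar> \<le> Z" "\<And>p q. p \<in> I \<Longrightarrow> q \<in> I \<Longrightarrow> p \<noteq> q \<Longrightarrow> c p q = a"
  proof (cases "\<exists>p\<in>I. \<exists>q\<in>I. p \<noteq> q")
    case True
    then obtain p q where pq: "p \<in> I" "q \<in> I" "p \<noteq> q" by blast
    \<comment> \<open>\<open>swap\<close> changes the second index; \<open>sym\<close> gives access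
      to the first.\<close>
    have "c p' q' = c p q" if "p' \<in> I" "q' \<in> I" "p' \<noteq> q'" for p' q'
      using swap sym pq that by metis
    with abs_c that show thesis by blast
  next
    case False
    \<comment> \<open>With at most one site there are no off-diagonal pairs, so any \<open>a\<close>
      within the bound will do.\<close>
    then show thesis using that[of 0] Z0 by auto
  qed
  \<comment> \<open>Since \<open>S \<subseteq> T\<close>, each \<open>p\<close> in \<open>S\<close>
    meets itself exactly once in \<open>T\<close>: one diagonal term \<open>Z\<close> and
    \<open>card T - 1\<close> copies of \<open>a\<close>. All three products in the expanded square
    have this form because \<open>G \<subseteq> I\<close>.\<close>
  have pair: "(\<Sum>A\<in>Pow I. g (card A) * ((\<Sum>p\<in>S. spin A p) * (\<Sum>q\<in>T. spin A q)))
       = card S * Z + (real (card S) * real (card T) - real (card S)) * a" if "S \<subseteq> T" "T \<subseteq> I" for S T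
  proof -
    have fT: "finite T"
      using that(2) fin by (rule finite_subset)
    have "(\<Sum>A\<in>Pow I. g (card A) * ((\<Sum>p\<in>S. spin A p) * (\<Sum>q\<in>T. spin A q)))
        = (\<Sum>A\<in>Pow I. \<Sum>p\<in>S. \<Sum>q\<in>T. g (card A) * (spin A p * spin A q))"
      unfolding sum_product by (simp only: sum_distrib_left)
    also have "\<dots> = (\<Sum>p\<in>S. \<Sum>q\<in>T. c p q)"
      unfolding c_def
      by (subst sum.swap, rule sum.cong[OF refl], subst sum.swap, rule refl)
    also have "\<dots> = (\<Sum>p\<in>S. Z + (real (card T) - 1) * a)"
    proof (rule sum.cong[OF refl])
      fix p assume p: "p \<in> S"
      then have "(\<Sum>q\<in>T. c p q) = c p p + (\<Sum>q\<in>T - {p}. c p q)"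
        using that fT by (intro sum.remove) auto
      also have "(\<Sum>q\<in>T - {p}. c p q) = (\<Sum>q\<in>T - {p}. a)"
        using that p by (intro sum.cong a) auto
      also have "\<dots> = (real (card T) - 1) * a"
        using p that fT card_gt_0_iff[of T] by (auto simp: card_Diff_singleton of_nat_diff Suc_leI)
      finally show "(\<Sum>q\<in>T. c p q) = Z + (real (card T) - 1) * a"
        by (simp add: diag)
    qed
    also have "\<dots> = card S * Z + (real (card S) * real (card T) - real (card S)) * a"
      by (simp add: algebra_simps)
    finally show ?thesis .
  qed
  define n where "n = real (card G)"
  define N where "N = real (card I)"
  have n: "0 < n" and nN: "n \<le> N"
    using G fin by (auto simp: n_def N_def card_gt_0_iff card_mono dest: finite_subset)
  then have N: "0 < N" by simp
  have "(\<Sum>A\<in>Pow I. g (card A) * ((\<Sum>p\<in>G. spin A p) / n - (\<Sum>p\<in>I. spin A p) / N)\<^sup>2)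
      = (\<Sum>A\<in>Pow I. g (card A) * ((\<Sum>p\<in>G. spin A p) * (\<Sum>p\<in>G. spin A p)) / n\<^sup>2
           - 2 * (g (card A) * ((\<Sum>p\<in>G. spin A p) * (\<Sum>p\<in>I. spin A p)) / (n * N))
           + g (card A) * ((\<Sum>p\<in>I. spin A p) * (\<Sum>p\<in>I. spin A p)) / N\<^sup>2)"
    by (intro sum.cong refl) (simp add: power2_eq_square algebra_simps diff_divide_distrib)
  also have "\<dots> = (n * Z + (n * n - n) * a) / n\<^sup>2 - 2 * ((n * Z + (n * N - n) * a) / (n * N))
           + (N * Z + (N * N - N) * a) / N\<^sup>2"
    using pair[of G G] pair[of G I] pair[of I I] G
    by (simp add: sum.distrib sum_subtractf flip: sum_divide_distrib sum_distrib_left n_def N_def)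
  also have "\<dots> = (Z - a) * (1 / n - 1 / N)"
    using n N by (simp add: field_simps power2_eq_square)
  also have "\<dots> \<le> (2 * Z) * (1 / n)"
    using a(1) n N nN Z0 by (intro mult_mono) (auto simp: frac_le)
  finally show ?thesis
    by (simp add: n_def N_def Z_def)
qed

subsection \<open>Concentration of the total magnetization\<close>

lemma tanh_less_self:
  fixes t :: real
  assumes "0 < t"
  shows "tanh t < t"
proof -
  have "((\<lambda>t. t - tanh t) has_real_derivative (tanh x)\<^sup>2) (at x)" for x :: real
    by (auto intro!: derivative_eq_intros)
  then have "\<exists>z. 0 < z \<and> z < t \<and> (t - tanh t) - (0 - tanh 0) = (t - 0) * (tanh z)\<^sup>2"
    using assms by (intro MVT2) auto
  then obtain z where "0 < z" "t - tanh t = t * (tanh z)\<^sup>2"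
    by auto
  moreover from this have "0 < t * (tanh z)\<^sup>2"
    using assms by simp
  ultimately show ?thesis
    by linarith
qed

lemma magnetization_nonneg: "0 \<le> magnetization \<beta>"
  using theI'[OF magnetization_ex1[of \<beta>]] by (auto simp: magnetization_def)

lemma tanh_magnetization: "tanh (\<beta> * magnetization \<beta>) = magnetization \<beta>"
  using theI'[OF magnetization_ex1[of \<beta>]] by (auto simp: magnetization_def)

lemma magnetization_lt_1: "magnetization \<beta> < 1"
  by (metis tanh_magnetization tanh_real_lt_1)

lemma tanh_mult_less_self_of_le_1:
  fixes \<beta> t :: real
  assumes "\<beta> \<le> 1" "0 < t"
  shows "tanh (\<beta> * t) < t"
proof -
  have "tanh (\<beta> * t) \<le> tanh t"
    using assms by simp
  also have "tanh t < t"
    by (rule tanh_less_self) fact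
  finally show ?thesis .
qed

text \<open>For \<beta> \<le> 1 the hypotheses are contradictory; for \<beta> > 1 this is the
  uniqueness behind \<open>THE\<close>. It identifies every positive zero that the intermediate
  value theorem produces below.\<close>

lemma tanh_fixpoint_imp_magnetization:
  assumes "0 < t" "tanh (\<beta> * t) = t"
  shows "t = magnetization \<beta>"
  using assms tanh_mult_less_self_of_le_1[of \<beta> t] the1_equality[OF magnetization_ex1[of \<beta>], of t]
  by (cases "\<beta> \<le> 1") (auto simp: magnetization_def)

text \<open>Since \<open>tanh\<close> stays below 1, \<open>tanh (\<beta> * s) - s\<close> is not
  positive at \<open>s = max 1 t\<close>. Were it nonnegative at \<open>t\<close>, there would be a
  fixed point at or beyond \<open>t\<close>, hence above the magnetization.\<close>

lemma tanh_mult_less_self: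
  assumes "magnetization \<beta> < t"
  shows "tanh (\<beta> * t) < t"
proof (rule ccontr)
  assume "\<not> tanh (\<beta> * t) < t"
  moreover have "tanh (\<beta> * max 1 t) \<le> max 1 t"
    using tanh_real_lt_1[of "\<beta> * max 1 t"] by linarith
  ultimately have "\<exists>s\<ge>t. s \<le> max 1 t \<and> tanh (\<beta> * s) - s = 0"
    by (intro IVT2') (auto intro!: continuous_intros)
  then obtain s where "t \<le> s" "tanh (\<beta> * s) = s"
    by auto
  then show False
    using assms magnetization_nonneg[of \<beta>] tanh_fixpoint_imp_magnetization[of s \<beta>] by linarith
qed

text \<open>A positive magnetization forces \<beta> > 1, so \<open>tanh (\<beta> * s) - s\<close>
  has slope \<beta> - 1 > 0 at 0 and is positive just to the right of it. If it were not positive at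
  \<open>t\<close>, a positive fixed point below the magnetization would appear.\<close>

lemma self_less_tanh_mult:
  assumes "0 < t" "t < magnetization \<beta>"
  shows "t < tanh (\<beta> * t)"
proof (rule ccontr)
  assume le: "\<not> t < tanh (\<beta> * t)"
  have \<beta>: "1 < \<beta>"
    using assms by (simp add: magnetization_def split: if_splits)
  have "((\<lambda>t. tanh (\<beta> * t) - t) has_real_derivative \<beta> - 1) (at 0)"
    by (auto intro!: derivative_eq_intros)
  from DERIV_pos_inc_right[OF this] \<beta>
  obtain d where d: "0 < d" "\<And>h. 0 < h \<Longrightarrow> h < d \<Longrightarrow> 0 < tanh (\<beta> * h) - h"
    by auto
  define e where "e = min t (d / 2)"
  have e: "0 < e" "e \<le> t" "e < d"
    using d(1) assms by (auto simp: e_def)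
  then have "\<exists>s\<ge>e. s \<le> t \<and> tanh (\<beta> * s) - s = 0"
    using d(2)[of e] le by (intro IVT2') (auto intro!: continuous_intros)
  then obtain s where "e \<le> s" "s \<le> t" "tanh (\<beta> * s) = s"
    by auto
  then show False
    using e assms tanh_fixpoint_imp_magnetization[of s \<beta>] by linarith
qed

section \<open>The limiting quotient of consecutive masses\<close>

definition growth :: "real \<Rightarrow> real \<Rightarrow> real" where
  "growth \<beta> t = (1 - t) / (1 + t) * exp (2 * \<beta> * t)"

text \<open>With \<open>u = exp (2 * \<beta> * t)\<close> one has
  \<open>tanh (\<beta> * t) = (u - 1) / (u + 1)\<close>. Once the positive denominators are cleared,
  both sides of each equivalence compare \<open>t * (u + 1)\<close> with
  \<open>u - 1\<close>.\<close>

lemma growth_sign: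
  assumes "0 \<le> t"
  shows "1 < growth \<beta> t \<longleftrightarrow> t < tanh (\<beta> * t)" "growth \<beta> t < 1 \<longleftrightarrow> tanh (\<beta> * t) < t"
proof -
  define u where "u = exp (2 * \<beta> * t)"
  have u: "0 < u" "exp (- (2 * (\<beta> * t))) = 1 / u"
    by (simp_all add: u_def exp_minus inverse_eq_divide mult.assoc)
  have "tanh (\<beta> * t) = (u - 1) / (u + 1)"
  proof -
    have "1 - 1 / u = (u - 1) / u" "1 + 1 / u = (u + 1) / u"
      using u(1) by (simp_all add: field_simps)
    then show ?thesis
      unfolding tanh_real_altdef mult_minus_left u(2) using u(1) by simp
  qed
  then have "t < tanh (\<beta> * t) \<longleftrightarrow> t * (u + 1) < u - 1" "tanh (\<beta> * t) < t \<longleftrightarrow> u - 1 < t * (u + 1)"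
    using u(1) by (simp_all add: pos_less_divide_eq pos_divide_less_eq)
  moreover have "1 < growth \<beta> t \<longleftrightarrow> 1 + t < (1 - t) * u" "growth \<beta> t < 1 \<longleftrightarrow> (1 - t) * u < 1 + t"
    unfolding growth_def u_def[symmetric] using assms
    by (simp_all add: pos_less_divide_eq pos_divide_less_eq)
  ultimately show "1 < growth \<beta> t \<longleftrightarrow> t < tanh (\<beta> * t)" "growth \<beta> t < 1 \<longleftrightarrow> tanh (\<beta> * t) < t"
    by (auto simp: algebra_simps)
qed

lemma growth_gt_1: "0 < t \<Longrightarrow> t < magnetization \<beta> \<Longrightarrow> 1 < growth \<beta> t"
  by (simp add: growth_sign self_less_tanh_mult)

lemma growth_lt_1: "magnetization \<beta> < t \<Longrightarrow> growth \<beta> t < 1"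
  using magnetization_nonneg[of \<beta>] by (simp add: growth_sign tanh_mult_less_self)

text \<open>At \<open>t = 0\<close> the quotient equals 1, so only the weak inequality extends to
  that endpoint.\<close>

lemma growth_ge_1:
  assumes "0 \<le> t" "t < magnetization \<beta>"
  shows "1 \<le> growth \<beta> t"
  using growth_gt_1[of t \<beta>] assms by (cases "t = 0") (auto simp: growth_def)

lemma continuous_on_growth:
  assumes "S \<subseteq> {0..}"
  shows "continuous_on S (growth \<beta>)"
  unfolding growth_def using assms by (intro continuous_intros) force

text \<open>Compactness turns the pointwise strict inequality into a uniform rate;
  \<open>a > 0\<close> excludes 0, where \<open>growth\<close> equals 1. On an empty interval any
  rate above 1 serves.\<close>

lemma growth_bounded_above_1:
  assumes "0 < a" "b < magnetization \<beta>"
  obtains Q where "1 < Q" "\<And>t. a \<le> t \<Longrightarrow> t \<le> b \<Longrightarrow> Q \<le> growth \<beta> t"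
proof (cases "a \<le> b")
  case True
  have "continuous_on {a..b} (growth \<beta>)"
    using assms by (intro continuous_on_growth) auto
  then obtain s where s: "s \<in> {a..b}" "\<And>t. t \<in> {a..b} \<Longrightarrow> growth \<beta> s \<le> growth \<beta> t"
    using continuous_attains_inf[of "{a..b}" "growth \<beta>"] True by auto
  then show thesis
    using that[of "growth \<beta> s"] growth_gt_1[of s \<beta>] assms by auto
qed (use that[of 2] in auto)

lemma growth_bounded_below_1:
  assumes "magnetization \<beta> < a"
  obtains q where "0 < q" "q < 1" "\<And>t. a \<le> t \<Longrightarrow> t \<le> 1 \<Longrightarrow> growth \<beta> t \<le> q"
proof (cases "a \<le> 1")
  case True
  have "continuous_on {a..1} (growth \<beta>)"
    using assms magnetization_nonneg[of \<beta>] by (intro continuous_on_growth) auto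
  then obtain s where s: "s \<in> {a..1}" "\<And>t. t \<in> {a..1} \<Longrightarrow> growth \<beta> t \<le> growth \<beta> s"
    using continuous_attains_sup[of "{a..1}" "growth \<beta>"] True by auto
  then show thesis
    \<comment> \<open>The maximum with \<open>1/2\<close> keeps \<open>q\<close> positive when
      \<open>growth\<close> vanishes at \<open>s\<close>, as it does for
      \<open>s = 1\<close>.\<close>
    using that[of "max (growth \<beta> s) (1/2)"] growth_lt_1[of \<beta> s] assms by fastforce
qed (use that[of "1/2"] in auto)

section \<open>The unnormalised law of the number of plus spins\<close>

definition cw_factor :: "real \<Rightarrow> nat \<Rightarrow> nat \<Rightarrow> real" where
  "cw_factor \<beta> N k = exp (\<beta> * (2 * real k - real N)\<^sup>2 / (2 * real N))"

lemma cw_factor_pos: "0 < cw_factor \<beta> N k"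
  by (simp add: cw_factor_def)

text \<open>The binomial coefficient counts the configurations with \<open>k\<close> plus spins,
  each of total spin \<open>2 * k - N\<close>.\<close>

definition cw_mass :: "real \<Rightarrow> nat \<Rightarrow> nat \<Rightarrow> real" where
  "cw_mass \<beta> N k = real (N choose k) * cw_factor \<beta> N k"

lemma cw_mass_nonneg: "0 \<le> cw_mass \<beta> N k"
  by (simp add: cw_mass_def cw_factor_pos less_imp_le)

lemma cw_mass_sum_pos: "0 < (\<Sum>k\<le>N. cw_mass \<beta> N k)"
proof (rule sum_pos2)
  show "0 < cw_mass \<beta> N N"
    by (simp add: cw_mass_def cw_factor_pos less_imp_le)
qed (auto simp: cw_mass_nonneg)

lemma cw_factor_reflect:
  assumes "k \<le> N"
  shows "cw_factor \<beta> N (N - k) = cw_factor \<beta> N k"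
proof -
  have "(2 * real (N - k) - real N)\<^sup>2 = (2 * real k - real N)\<^sup>2"
    using assms by (simp add: of_nat_diff power2_commute)
  then show ?thesis
    by (simp add: cw_factor_def)
qed

lemma cw_mass_reflect: "k \<le> N \<Longrightarrow> cw_mass \<beta> N (N - k) = cw_mass \<beta> N k"
  by (simp add: cw_mass_def cw_factor_reflect binomial_symmetric[symmetric])

text \<open>At the midpoint \<open>t\<close> between two neighbouring values of \<open>S / N\<close> the quotient of the
  masses equals \<open>growth \<beta> t\<close> up to an error of order \<open>1 / N\<close>.\<close>

lemma cw_mass_Suc:
  assumes "0 < N" "k \<le> N"
  defines "t \<equiv> (2 * real k + 1 - real N) / real N"
  shows "cw_mass \<beta> N (Suc k) =
    (real N * (1 - t) + 1) / (real N * (1 + t) + 1) * exp (2 * \<beta> * t) * cw_mass \<beta> N k"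
proof -
  have "Suc k * (N choose Suc k) = (N - k) * (N choose k)"
    using binomial_absorb_comp[of N k] binomial_absorption[of k N] by simp
  then have eq: "real (Suc k) * real (N choose Suc k) = real (N - k) * real (N choose k)"
    by (simp only: flip: of_nat_mult)
  have Nt: "real N * t = 2 * real k + 1 - real N"
    using assms by simp
  \<comment> \<open>These are the terms of the binomial quotient \<open>(N - k) / (k + 1)\<close>;
    the summands 1 are its whole discrepancy from \<open>(1 - t) / (1 + t)\<close>.\<close>
  have half: "real (Suc k) = (real N * (1 + t) + 1) / 2" "real (N - k) = (real N * (1 - t) + 1) / 2"
    using assms Nt by (simp_all add: algebra_simps of_nat_diff)
  have "0 < real (Suc k)"
    by simp
  then have "0 < real N * (1 + t) + 1"
    unfolding half by (simp only: half_gt_zero_iff)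
  then have binom: "real (N choose Suc k)
      = (real N * (1 - t) + 1) / (real N * (1 + t) + 1) * real (N choose k)"
    using eq unfolding half by (simp add: eq_divide_eq mult.commute)
  \<comment> \<open>The two squares differ by \<open>4 * (2 * k + 1 - N)\<close>, so at the midpoint
    the exponential factor is exact.\<close>
  have "\<beta> * (2 * real (Suc k) - real N)\<^sup>2 / (2 * real N)
      = 2 * \<beta> * t + \<beta> * (2 * real k - real N)\<^sup>2 / (2 * real N)"
    using assms by (simp add: field_simps power2_eq_square)
  then show ?thesis
    unfolding cw_mass_def cw_factor_def binom by (simp add: exp_add)
qed

text \<open>For \<open>t \<ge> 0\<close>, adding 1 to both \<open>N * (1 - t)\<close> and the larger
  \<open>N * (1 + t)\<close> can only raise their quotient, so the lower bound needs no error
  term.\<close>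

lemma cw_mass_Suc_ge:
  assumes "0 < N" "k \<le> N"
  defines "t \<equiv> (2 * real k + 1 - real N) / real N"
  assumes "0 \<le> t"
  shows "growth \<beta> t * cw_mass \<beta> N k \<le> cw_mass \<beta> N (Suc k)"
proof -
  have "0 < real N * (1 + t) + 1"
    using assms by (simp add: add_nonneg_pos)
  then have "(1 - t) / (1 + t) \<le> (real N * (1 - t) + 1) / (real N * (1 + t) + 1)"
    using assms(4) by (simp add: field_simps)
  then show ?thesis
    unfolding growth_def cw_mass_Suc[OF assms(1,2)] t_def[symmetric]
    by (intro mult_right_mono cw_mass_nonneg) auto
qed

text \<open>Dropping the 1 in the denominator leaves an excess of at most \<open>1 / N\<close> from
  the numerator, which the exponential inflates by at most \<open>exp (2 * \<beta>)\<close> as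
  \<open>t \<le> 1\<close>.\<close>

lemma cw_mass_Suc_le:
  assumes "0 \<le> \<beta>" "0 < N" "k \<le> N"
  defines "t \<equiv> (2 * real k + 1 - real N) / real N"
  assumes "0 \<le> t" "t \<le> 1"
  shows "cw_mass \<beta> N (Suc k) \<le> (growth \<beta> t + exp (2 * \<beta>) / real N) * cw_mass \<beta> N k"
proof -
  have N: "0 < real N" and t: "0 \<le> t" "t \<le> 1"
    using assms by auto
  have "(real N * (1 - t) + 1) / (real N * (1 + t) + 1) \<le> (real N * (1 - t) + 1) / (real N * (1 + t))"
    using N t by (intro frac_le) auto
  also have "\<dots> = (1 - t) / (1 + t) + 1 / (real N * (1 + t))"
    using N by (simp add: add_divide_distrib)
  also have "1 / (real N * (1 + t)) \<le> 1 / real N"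
    using N t by (intro frac_le) auto
  finally have "(real N * (1 - t) + 1) / (real N * (1 + t) + 1) * exp (2 * \<beta> * t)
      \<le> ((1 - t) / (1 + t) + 1 / real N) * exp (2 * \<beta> * t)"
    by (intro mult_right_mono) auto
  also have "\<dots> = growth \<beta> t + exp (2 * \<beta> * t) / real N"
    by (simp add: growth_def algebra_simps)
  also have "\<dots> \<le> growth \<beta> t + exp (2 * \<beta>) / real N"
    using assms(1) t by (intro add_left_mono divide_right_mono) (auto intro: mult_left_le)
  finally show ?thesis
    unfolding cw_mass_Suc[OF assms(2,3)] t_def[symmetric]
    by (intro mult_right_mono cw_mass_nonneg)
qed


text \<open>In units of \<open>S / N\<close>, the decay rate is harvested from a stretch of length \<open>\<epsilon> / 4\<close>
  between \<open>k\<close> and the mode; below the mode one first climbs a stretch of that length to stay away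
  from \<open>0\<close>, where \<open>growth\<close> equals \<open>1\<close>.\<close>

lemma cw_mass_decay:
  assumes \<beta>: "0 \<le> \<beta>" and \<epsilon>: "0 < \<epsilon>"
  obtains r where "0 < r" "r < 1"
    "\<forall>\<^sub>F N in sequentially. \<forall>k\<le>N. real N \<le> 2 * real k \<longrightarrow>
       \<epsilon> < \<bar>(2 * real k - real N) / real N - magnetization \<beta>\<bar> \<longrightarrow>
       cw_mass \<beta> N k \<le> r ^ nat \<lfloor>\<epsilon> * real N / 8\<rfloor> * (\<Sum>l\<le>N. cw_mass \<beta> N l)"
proof -
  define m where "m = magnetization \<beta>"
  have m: "0 \<le> m" "m < 1"
    by (simp_all add: m_def magnetization_nonneg magnetization_lt_1)
  \<comment> \<open>The margin \<open>\<epsilon> / 2\<close> below the mode is what remains of the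
    distance \<epsilon> after two stretches of length at most \<open>\<epsilon> / 4\<close>.\<close>
  obtain Q where Q: "1 < Q" "\<And>t. \<epsilon> / 8 \<le> t \<Longrightarrow> t \<le> m - \<epsilon> / 2 \<Longrightarrow> Q \<le> growth \<beta> t"
    using growth_bounded_above_1[of "\<epsilon> / 8" "m - \<epsilon> / 2" \<beta>] \<epsilon> by (auto simp: m_def)
  obtain q where q: "0 < q" "q < 1" "\<And>t. m + \<epsilon> / 2 \<le> t \<Longrightarrow> t \<le> 1 \<Longrightarrow> growth \<beta> t \<le> q"
    using growth_bounded_below_1[of \<beta> "m + \<epsilon> / 2"] \<epsilon> by (auto simp: m_def)
  \<comment> \<open>Any rate strictly between \<open>q\<close> and 1 absorbs the
    \<open>1 / N\<close> error of \<open>cw_mass_Suc_le\<close> for large \<open>N\<close>.\<close>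
  define q' where "q' = (1 + q) / 2"
  have q': "0 < q'" "q' < 1" "q < q'"
    using q by (simp_all add: q'_def)
  define r where "r = max (1 / Q) q'"
  have r: "0 < r" "r < 1" "1 / Q \<le> r" "q' \<le> r"
    using q' Q(1) by (simp_all add: r_def less_max_iff_disj)
  have "(\<lambda>N. q + exp (2 * \<beta>) / real N) \<longlonglongrightarrow> q"
    by real_asymp
  then have ev1: "\<forall>\<^sub>F N in sequentially. q + exp (2 * \<beta>) / real N < q'"
    using q'(3) by (rule order_tendstoD)
  have "filterlim (\<lambda>N. \<epsilon> * real N) at_top sequentially"
    using \<epsilon> by real_asymp
  \<comment> \<open>Rounding in \<open>j\<close> costs less than \<open>2 / N\<close> in
    \<open>S / N\<close>; for \<open>16 \<le> \<epsilon> * N\<close> the first stretch still lifts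
    \<open>t\<close> past \<open>\<epsilon> / 8\<close>.\<close>
  then have ev2: "\<forall>\<^sub>F N in sequentially. 16 \<le> \<epsilon> * real N"
    by (simp add: filterlim_at_top)
  have "\<forall>\<^sub>F N in sequentially. \<forall>k\<le>N. real N \<le> 2 * real k \<longrightarrow>
       \<epsilon> < \<bar>(2 * real k - real N) / real N - m\<bar> \<longrightarrow>
       cw_mass \<beta> N k \<le> r ^ nat \<lfloor>\<epsilon> * real N / 8\<rfloor> * (\<Sum>l\<le>N. cw_mass \<beta> N l)"
    using ev1 ev2 eventually_gt_at_top[of 0]
  proof eventually_elim
    case (elim N)
    \<comment> \<open>Neighbouring values of \<open>S / N\<close> are \<open>2 / N\<close> apart, so
      \<open>j\<close> steps cover at most \<open>\<epsilon> / 4\<close>.\<close>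
    define j where "j = nat \<lfloor>\<epsilon> * real N / 8\<rfloor>"
    have j: "8 * real j \<le> \<epsilon> * real N" "\<epsilon> * real N < 8 * real j + 8"
      unfolding j_def using elim(2) by linarith+
    have N: "0 < real N"
      using elim(3) by simp
    have le_total: "cw_mass \<beta> N l \<le> (\<Sum>l\<le>N. cw_mass \<beta> N l)" if "l \<le> N" for l
      using that by (intro member_le_sum) (auto simp: cw_mass_nonneg)
    define t where "t k = (2 * real k + 1 - real N) / real N" for k
    have t_iff: "x \<le> t k \<longleftrightarrow> x * real N \<le> 2 * real k + 1 - real N"
      "t k \<le> x \<longleftrightarrow> 2 * real k + 1 - real N \<le> x * real N" for x k
      using N by (simp_all add: t_def field_simps)
    show ?case
    proof (intro allI impI)
      fix k assume kN: "k \<le> N" and half: "real N \<le> 2 * real k"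
        and far: "\<epsilon> < \<bar>(2 * real k - real N) / real N - m\<bar>"
      have mN: "0 \<le> m * real N" "m * real N \<le> real N"
        using m N by (simp_all add: mult_left_le_one_le)
      consider "(2 * real k - real N) / real N < m - \<epsilon>" | "m + \<epsilon> < (2 * real k - real N) / real N"
        using far by linarith
      then show "cw_mass \<beta> N k \<le> r ^ nat \<lfloor>\<epsilon> * real N / 8\<rfloor> * (\<Sum>l\<le>N. cw_mass \<beta> N l)"
      proof cases
        case 1
        then have 1: "2 * real k - real N < m * real N - \<epsilon> * real N"
          using N by (simp add: field_simps)
        have climb: "cw_mass \<beta> N k \<le> cw_mass \<beta> N (k + i)" if "i \<le> j" for i
          using that
        proof (induction i)
          case (Suc i)
          have "0 \<le> t (k + i)" "t (k + i) \<le> m - \<epsilon> / 2" "k + i \<le> N"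
            unfolding t_iff using Suc.prems 1 half j mN by (simp_all add: algebra_simps)
          then have "1 * cw_mass \<beta> N (k + i) \<le> growth \<beta> (t (k + i)) * cw_mass \<beta> N (k + i)"
            using \<epsilon> by (intro mult_right_mono growth_ge_1 cw_mass_nonneg) (auto simp: m_def)
          also have "\<dots> \<le> cw_mass \<beta> N (Suc (k + i))"
            unfolding t_def using \<open>0 \<le> t (k + i)\<close> \<open>k + i \<le> N\<close> elim(3)
            by (intro cw_mass_Suc_ge) (auto simp: t_def)
          finally show ?case
            using Suc by simp
        qed simp
        have grow: "Q ^ i * cw_mass \<beta> N (k + j) \<le> cw_mass \<beta> N (k + j + i)" if "i \<le> j" for i
          using that
        proof (induction i)
          case (Suc i)
          have *: "\<epsilon> / 8 \<le> t (k + j + i)" "t (k + j + i) \<le> m - \<epsilon> / 2" "k + j + i \<le> N"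
            unfolding t_iff using Suc.prems 1 half j mN elim(2) by (simp_all add: algebra_simps)
          have "Q ^ Suc i * cw_mass \<beta> N (k + j) \<le> Q * cw_mass \<beta> N (k + j + i)"
            using Suc Q(1) by (simp add: mult.assoc)
          also have "\<dots> \<le> growth \<beta> (t (k + j + i)) * cw_mass \<beta> N (k + j + i)"
            using * by (intro mult_right_mono Q cw_mass_nonneg)
          also have "\<dots> \<le> cw_mass \<beta> N (Suc (k + j + i))"
            unfolding t_def using *(3) elim(3) order_trans[OF _ *(1), of 0] \<epsilon>
            by (intro cw_mass_Suc_ge) (auto simp: t_def)
          finally show ?case
            by simp
        qed simp
        have "k + j + j \<le> N"
          using 1 j mN by (simp add: algebra_simps)
        moreover have "Q ^ j * cw_mass \<beta> N k \<le> Q ^ j * cw_mass \<beta> N (k + j)"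
          using Q(1) by (intro mult_left_mono climb) auto
        ultimately have "Q ^ j * cw_mass \<beta> N k \<le> (\<Sum>l\<le>N. cw_mass \<beta> N l)"
          using grow[of j] le_total[of "k + j + j"] by linarith
        then have "cw_mass \<beta> N k \<le> (1 / Q) ^ j * (\<Sum>l\<le>N. cw_mass \<beta> N l)"
          using Q(1) by (simp add: field_simps power_divide)
        also have "\<dots> \<le> r ^ j * (\<Sum>l\<le>N. cw_mass \<beta> N l)"
          using Q(1) r by (intro mult_right_mono power_mono sum_nonneg cw_mass_nonneg) auto
        finally show ?thesis
          unfolding j_def .
      next
        case 2
        then have 2: "m * real N + \<epsilon> * real N < 2 * real k - real N"
          using N by (simp add: field_simps)
        have "j \<le> k"
          using 2 j mN by linarith
        \<comment> \<open>Above the mode the stretch runs from \<open>k - j\<close> up to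
          \<open>k\<close>; going back \<open>j\<close> steps from \<open>k\<close> stays beyond
          \<open>m + \<epsilon> / 2\<close>.\<close>
        have decay: "cw_mass \<beta> N (k - j + i) \<le> q' ^ i * cw_mass \<beta> N (k - j)" if "i \<le> j" for i
          using that
        proof (induction i)
          case (Suc i)
          have *: "m + \<epsilon> / 2 \<le> t (k - j + i)" "t (k - j + i) \<le> 1" "k - j + i \<le> N"
            unfolding t_iff using Suc.prems 2 \<open>j \<le> k\<close> j kN mN by (simp_all add: algebra_simps of_nat_diff)
          have "cw_mass \<beta> N (Suc (k - j + i))
              \<le> (growth \<beta> (t (k - j + i)) + exp (2 * \<beta>) / real N) * cw_mass \<beta> N (k - j + i)"
            unfolding t_def using *(2,3) elim(3) order_trans[OF _ *(1), of 0] \<epsilon> m \<beta>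
            by (intro cw_mass_Suc_le) (auto simp: t_def)
          also have "\<dots> \<le> q' * cw_mass \<beta> N (k - j + i)"
            using q(3)[OF *(1,2)] elim(1) by (intro mult_right_mono cw_mass_nonneg) linarith
          also have "\<dots> \<le> q' ^ Suc i * cw_mass \<beta> N (k - j)"
            using Suc q'(1) by (simp add: mult.assoc)
          finally show ?case
            by simp
        qed simp
        have "cw_mass \<beta> N k \<le> q' ^ j * cw_mass \<beta> N (k - j)"
          using decay[of j] \<open>j \<le> k\<close> by simp
        also have "\<dots> \<le> r ^ j * (\<Sum>l\<le>N. cw_mass \<beta> N l)"
          using r q' kN by (intro mult_mono power_mono le_total cw_mass_nonneg) auto
        finally show ?thesis
          unfolding j_def .
      qed
    qed
  qed
  from this[unfolded m_def] show thesis
    by (rule that[OF r(1,2)])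
qed

text \<open>At most \<open>N + 1\<close> values of \<open>k\<close> are bad, and each has a relative
  mass exponentially small in \<open>N\<close>, so a union bound suffices.\<close>

lemma cw_mass_concentration:
  assumes \<beta>: "0 \<le> \<beta>" and \<epsilon>: "0 < \<epsilon>"
  shows "(\<lambda>N. (\<Sum>k | k \<le> N \<and> \<epsilon> < \<bar>\<bar>2 * real k - real N\<bar> / real N - magnetization \<beta>\<bar>. cw_mass \<beta> N k)
          / (\<Sum>k\<le>N. cw_mass \<beta> N k)) \<longlonglongrightarrow> 0"
proof -
  define bad where "bad N k \<longleftrightarrow> \<epsilon> < \<bar>\<bar>2 * real k - real N\<bar> / real N - magnetization \<beta>\<bar>" for N k
  obtain r where r: "0 < r" "r < 1" and ev:
    "\<forall>\<^sub>F N in sequentially. \<forall>k\<le>N. real N \<le> 2 * real k \<longrightarrow>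
       \<epsilon> < \<bar>(2 * real k - real N) / real N - magnetization \<beta>\<bar> \<longrightarrow>
       cw_mass \<beta> N k \<le> r ^ nat \<lfloor>\<epsilon> * real N / 8\<rfloor> * (\<Sum>l\<le>N. cw_mass \<beta> N l)"
    using cw_mass_decay[OF assms] .
  have bound: "\<forall>\<^sub>F N in sequentially.
     norm ((\<Sum>k | k \<le> N \<and> bad N k. cw_mass \<beta> N k) / (\<Sum>k\<le>N. cw_mass \<beta> N k))
       \<le> (real N + 1) * r powr (\<epsilon> * real N / 8 - 1)"
    using ev
  proof eventually_elim
    case (elim N)
    define T where "T = (\<Sum>k\<le>N. cw_mass \<beta> N k)"
    define R where "R = r ^ nat \<lfloor>\<epsilon> * real N / 8\<rfloor>"
    have T: "0 < T"
      unfolding T_def by (rule cw_mass_sum_pos)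
    have le: "cw_mass \<beta> N k \<le> R * T" if "k \<le> N" "bad N k" for k
    proof (cases "real N \<le> 2 * real k")
      case True
      then show ?thesis
        using elim that unfolding T_def R_def bad_def by auto
    next
      case False
      \<comment> \<open>Negative totals reduce to positive ones: passing to \<open>N - k\<close>
        keeps both the mass and \<open>|2 * k - N|\<close>.\<close>
      then have "cw_mass \<beta> N (N - k) \<le> R * T"
        using elim that unfolding T_def R_def bad_def by (auto simp: of_nat_diff algebra_simps)
      then show ?thesis
        using that by (simp add: cw_mass_reflect)
    qed
    have "(\<Sum>k | k \<le> N \<and> bad N k. cw_mass \<beta> N k) \<le> (\<Sum>k | k \<le> N \<and> bad N k. R * T)"
      using le by (intro sum_mono) auto
    also have "\<dots> \<le> (\<Sum>k\<le>N. R * T)"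
      using T r by (intro sum_mono2) (auto simp: R_def)
    also have "\<dots> = (real N + 1) * R * T"
      by simp
    finally have "(\<Sum>k | k \<le> N \<and> bad N k. cw_mass \<beta> N k) / T \<le> (real N + 1) * R"
      using T by (simp add: pos_divide_le_eq)
    moreover have "0 \<le> (\<Sum>k | k \<le> N \<and> bad N k. cw_mass \<beta> N k) / T"
      using T by (intro divide_nonneg_pos sum_nonneg cw_mass_nonneg)
    \<comment> \<open>As \<open>r < 1\<close>, lowering the exponent from the floor to its argument
      minus 1 enlarges the power and removes the rounding before the limit is taken.\<close>
    moreover have "R \<le> r powr (\<epsilon> * real N / 8 - 1)"
    proof -
      have "R = r powr real (nat \<lfloor>\<epsilon> * real N / 8\<rfloor>)"
        using r by (simp add: R_def powr_realpow)
      also have "\<dots> \<le> r powr (\<epsilon> * real N / 8 - 1)"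
        using r by (intro powr_mono') linarith+
      finally show ?thesis .
    qed
    then have "(real N + 1) * R \<le> (real N + 1) * r powr (\<epsilon> * real N / 8 - 1)"
      by (intro mult_left_mono) auto
    ultimately show ?case
      unfolding T_def[symmetric] real_norm_def by linarith
  qed
  have "(\<lambda>N. (real N + 1) * exp (- ((\<epsilon> * real N / 8 - 1) * c))) \<longlonglongrightarrow> 0" if "0 < c" for c :: real
    using \<epsilon> that by real_asymp
  from this[of "- ln r"] have "(\<lambda>N. (real N + 1) * exp (- ((\<epsilon> * real N / 8 - 1) * - ln r))) \<longlonglongrightarrow> 0"
    using r by simp
  then have "(\<lambda>N. (real N + 1) * r powr (\<epsilon> * real N / 8 - 1)) \<longlonglongrightarrow> 0"
    using r by (simp add: powr_def)
  with bound show ?thesis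
    unfolding bad_def by (rule Lim_null_comparison)
qed

subsection \<open>Expectations in the homogeneous model\<close>

lemma sum_Pow_card:
  fixes f :: "nat \<Rightarrow> real"
  assumes "finite I"
  shows "(\<Sum>A\<in>Pow I. f (card A)) = (\<Sum>k\<le>card I. real (card I choose k) * f k)"
proof -
  have "(\<Sum>A\<in>Pow I. f (card A)) = (\<Sum>k\<le>card I. \<Sum>A | A \<in> Pow I \<and> card A = k. f (card A))"
    using assms by (intro sum.group[symmetric]) (auto intro: card_mono)
  also have "\<dots> = (\<Sum>k\<le>card I. real (card I choose k) * f k)"
  proof (rule sum.cong[OF refl])
    fix k
    have "(\<Sum>A | A \<in> Pow I \<and> card A = k. f (card A)) = (\<Sum>A | A \<subseteq> I \<and> card A = k. f k)"
      by (intro sum.cong) auto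
    then show "(\<Sum>A | A \<in> Pow I \<and> card A = k. f (card A)) = real (card I choose k) * f k"
      by (simp add: n_subsets assms)
  qed
  finally show ?thesis .
qed

section \<open>Encoding of configurations by sets of sites\<close>

definition sites :: "('m::finite \<Rightarrow> nat) \<Rightarrow> ('m \<times> nat) set" where
  "sites n = (SIGMA \<kappa>:UNIV. {1..n \<kappa>})"

lemma finite_sites [simp]: "finite (sites n)"
  by (simp add: sites_def)

lemma card_sites: "card (sites n) = (\<Sum>\<kappa>\<in>UNIV. n \<kappa>)"
  by (simp add: sites_def)

text \<open>A configuration is encoded by the set of its plus spins.\<close>

definition spin_config :: "('m::finite \<Rightarrow> nat) \<Rightarrow> ('m \<times> nat) set \<Rightarrow> 'm \<Rightarrow> nat \<Rightarrow> real" where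
  "spin_config n A = (\<lambda>\<kappa>. \<lambda>i\<in>{1..n \<kappa>}. spin A (\<kappa>, i))"

text \<open>The inverse collects the sites with spin 1. It loses nothing: a configuration takes
  values in \<open>{-1, 1}\<close> on the sites and is \<open>undefined\<close> elsewhere.\<close>

lemma bij_betw_spin_config: "bij_betw (spin_config n) (Pow (sites n)) (spin_configs n)"
proof (rule bij_betwI[where g = "\<lambda>x. {(\<kappa>, i). i \<in> {1..n \<kappa>} \<and> x \<kappa> i = 1}"])
  show "spin_config n \<in> Pow (sites n) \<rightarrow> spin_configs n"
    by (auto simp: spin_config_def spin_configs_def spin_def PiE_iff)
  show "(\<lambda>x. {(\<kappa>, i). i \<in> {1..n \<kappa>} \<and> x \<kappa> i = 1}) \<in> spin_configs n \<rightarrow> Pow (sites n)"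
    by (auto simp: sites_def)
  show "{(\<kappa>, i). i \<in> {1..n \<kappa>} \<and> spin_config n A \<kappa> i = 1} = A" if "A \<in> Pow (sites n)" for A
    using that by (auto simp: spin_config_def spin_def sites_def split: if_splits)
  show "spin_config n {(\<kappa>, i). i \<in> {1..n \<kappa>} \<and> x \<kappa> i = 1} = x" if "x \<in> spin_configs n" for x
  proof (intro ext)
    fix \<kappa> i
    have "x \<kappa> i \<in> {-1, 1}" if "i \<in> {1..n \<kappa>}"
      using that \<open>x \<in> spin_configs n\<close> unfolding spin_configs_def PiE_iff by blast
    moreover have "x \<kappa> i = undefined" if "i \<notin> {1..n \<kappa>}"
      using that \<open>x \<in> spin_configs n\<close> unfolding spin_configs_def PiE_iff extensional_def by blast
    ultimately show "spin_config n {(\<kappa>, i). i \<in> {1..n \<kappa>} \<and> x \<kappa> i = 1} \<kappa> i = x \<kappa> i"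
      by (cases "i \<in> {1..n \<kappa>}") (auto simp: spin_config_def spin_def)
  qed
qed

lemma sum_sites:
  fixes f :: "'m::finite \<times> nat \<Rightarrow> real"
  shows "(\<Sum>\<kappa>\<in>UNIV. \<Sum>i=1..n \<kappa>. f (\<kappa>, i)) = (\<Sum>p\<in>sites n. f p)"
  unfolding sites_def by (subst sum.Sigma) (auto simp: split_beta)

text \<open>Equal couplings let the double sum over groups factor into \<beta> times the square of
  the total spin, so the group structure disappears from the weight and spins of different groups
  become exchangeable.\<close>

lemma gibbs_weight_spin_config:
  assumes "homogeneous_coupling J \<beta>" "A \<subseteq> sites n"
  shows "gibbs_weight J n (spin_config n A) = cw_factor \<beta> (card (sites n)) (card A)"
proof -
  have "(\<Sum>\<kappa>\<in>UNIV. \<Sum>\<mu>\<in>UNIV. J $ \<kappa> $ \<mu> *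
           (\<Sum>i=1..n \<kappa>. \<Sum>j=1..n \<mu>. spin_config n A \<kappa> i * spin_config n A \<mu> j))
      = (\<Sum>\<kappa>\<in>UNIV. \<Sum>\<mu>\<in>UNIV. \<beta> * ((\<Sum>i=1..n \<kappa>. spin A (\<kappa>, i)) * (\<Sum>j=1..n \<mu>. spin A (\<mu>, j))))"
    using assms by (simp add: homogeneous_coupling_def spin_config_def sum_product)
  also have "\<dots> = \<beta> * ((\<Sum>\<kappa>\<in>UNIV. \<Sum>i=1..n \<kappa>. spin A (\<kappa>, i)) * (\<Sum>\<mu>\<in>UNIV. \<Sum>j=1..n \<mu>. spin A (\<mu>, j)))"
    by (subst sum_product) (simp only: sum_distrib_left)
  also have "\<dots> = \<beta> * (\<Sum>p\<in>sites n. spin A p)\<^sup>2"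
    by (simp only: power2_eq_square sum_sites)
  finally show ?thesis
    using assms by (simp add: gibbs_weight_def cw_factor_def sum_spin flip: card_sites)
qed

section \<open>Expectations as finite sums over sets of plus sites\<close>

definition spin_means :: "('m::finite \<Rightarrow> nat) \<Rightarrow> ('m \<times> nat) set \<Rightarrow> real ^ 'm" where
  "spin_means n A = (\<chi> \<kappa>. (\<Sum>i=1..n \<kappa>. spin A (\<kappa>, i)) / real (n \<kappa>))"

definition cw_expectation ::
  "real \<Rightarrow> ('m::finite \<Rightarrow> nat) \<Rightarrow> (('m \<times> nat) set \<Rightarrow> real) \<Rightarrow> real" where
  "cw_expectation \<beta> n h = (\<Sum>A\<in>Pow (sites n). cw_factor \<beta> (card (sites n)) (card A) * h A)
     / (\<Sum>A\<in>Pow (sites n). cw_factor \<beta> (card (sites n)) (card A))"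

lemma cw_normalization_pos: "0 < (\<Sum>A\<in>Pow (sites n). cw_factor \<beta> (card (sites n)) (card A))"
  by (intro sum_pos) (auto simp: cw_factor_pos)

lemma cw_expectation_mono:
  assumes "\<And>A. A \<subseteq> sites n \<Longrightarrow> h A \<le> h' A"
  shows "cw_expectation \<beta> n h \<le> cw_expectation \<beta> n h'"
  unfolding cw_expectation_def using assms cw_normalization_pos[of \<beta> n]
  by (intro divide_right_mono sum_mono mult_left_mono) (auto simp: cw_factor_pos less_imp_le)

lemma cw_expectation_const: "cw_expectation \<beta> n (\<lambda>A. c) = c"
  unfolding cw_expectation_def using cw_normalization_pos[of \<beta> n]
  by (simp flip: sum_distrib_right)

lemma cw_expectation_add:
  "cw_expectation \<beta> n (\<lambda>A. h A + h' A) = cw_expectation \<beta> n h + cw_expectation \<beta> n h'"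
  by (simp add: cw_expectation_def distrib_left sum.distrib add_divide_distrib)

lemma cw_expectation_cmult: "cw_expectation \<beta> n (\<lambda>A. c * h A) = c * cw_expectation \<beta> n h"
  unfolding cw_expectation_def by (simp add: sum_distrib_left mult.left_commute)

lemma cw_expectation_sum:
  "cw_expectation \<beta> n (\<lambda>A. \<Sum>x\<in>S. h x A) = (\<Sum>x\<in>S. cw_expectation \<beta> n (h x))"
  unfolding cw_expectation_def
  by (simp only: sum_distrib_left sum_divide_distrib) (rule sum.swap)

lemma abs_cw_expectation_le: "\<bar>cw_expectation \<beta> n h\<bar> \<le> cw_expectation \<beta> n (\<lambda>A. \<bar>h A\<bar>)"
  using cw_expectation_mono[of n h "\<lambda>A. \<bar>h A\<bar>" \<beta>] cw_expectation_mono[of n "\<lambda>A. -1 * h A" "\<lambda>A. \<bar>h A\<bar>" \<beta>]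
  unfolding cw_expectation_cmult by (simp add: abs_le_iff abs_ge_minus_self)

text \<open>Complementing \<open>A\<close> negates every spin and replaces \<open>card A\<close> by
  \<open>N - card A\<close>, which leaves the factor unchanged.\<close>

lemma cw_expectation_spin_flip:
  "cw_expectation \<beta> n (\<lambda>A. h (spin_means n A)) = cw_expectation \<beta> n (\<lambda>A. h (- spin_means n A))"
proof -
  have "spin (sites n - A) (\<kappa>, i) = - spin A (\<kappa>, i)" if "i \<in> {1..n \<kappa>}" for A \<kappa> i
    using that by (simp add: spin_def sites_def)
  then have "spin_means n (sites n - A) = - spin_means n A" for A
    by (simp add: spin_means_def vec_eq_iff sum_negf)
  moreover have "card (sites n - A) = card (sites n) - card A" "card A \<le> card (sites n)"
    if "A \<subseteq> sites n" for A
    using that by (auto simp: card_Diff_subset finite_subset card_mono)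
  ultimately have "(\<Sum>A\<in>Pow (sites n). cw_factor \<beta> (card (sites n)) (card A) * h (spin_means n A))
      = (\<Sum>A\<in>Pow (sites n). cw_factor \<beta> (card (sites n)) (card A) * h (- spin_means n A))"
    by (intro sum.reindex_bij_witness[of _ "\<lambda>A. sites n - A" "\<lambda>A. sites n - A"])
       (auto simp: double_diff cw_factor_reflect)
  then show ?thesis
    by (simp add: cw_expectation_def)
qed

text \<open>Reduces events about the number of plus spins to the masses for which concentration is
  known.\<close>

lemma cw_expectation_of_bool_card:
  "cw_expectation \<beta> n (\<lambda>A. of_bool (Q (card A)))
     = (\<Sum>k | k \<le> card (sites n) \<and> Q k. cw_mass \<beta> (card (sites n)) k)
         / (\<Sum>k\<le>card (sites n). cw_mass \<beta> (card (sites n)) k)"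
proof -
  let ?N = "card (sites n)"
  have "(\<Sum>A\<in>Pow (sites n). cw_factor \<beta> ?N (card A)) = (\<Sum>k\<le>?N. cw_mass \<beta> ?N k)"
    by (simp add: sum_Pow_card cw_mass_def)
  moreover have "(\<Sum>A\<in>Pow (sites n). cw_factor \<beta> ?N (card A) * of_bool (Q (card A)))
      = (\<Sum>k\<le>?N. cw_mass \<beta> ?N k * of_bool (Q k))"
    using sum_Pow_card[OF finite_sites, of "\<lambda>k. cw_factor \<beta> ?N k * of_bool (Q k)"]
    by (simp only: cw_mass_def mult.assoc)
  moreover have "(\<Sum>k\<le>?N. cw_mass \<beta> ?N k * of_bool (Q k)) = (\<Sum>k | k \<le> ?N \<and> Q k. cw_mass \<beta> ?N k)"
    by (intro sum.mono_neutral_cong_right) auto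
  ultimately show ?thesis
    by (simp add: cw_expectation_def)
qed

lemma cw_expectation_group_deviation:
  assumes "0 < n \<kappa>"
  shows "cw_expectation \<beta> n
      (\<lambda>A. (spin_means n A $ \<kappa> - (2 * real (card A) - real (card (sites n))) / real (card (sites n)))\<^sup>2)
    \<le> 2 / real (n \<kappa>)"
proof -
  let ?N = "card (sites n)" and ?G = "Pair \<kappa> ` {1..n \<kappa>}"
  have G: "(\<Sum>p\<in>?G. spin A p) = (\<Sum>i=1..n \<kappa>. spin A (\<kappa>, i))" for A
    by (subst sum.reindex) (auto simp: inj_on_def)
  have card: "card ?G = n \<kappa>"
    by (subst card_image) (auto simp: inj_on_def)
  have "?G \<subseteq> sites n" "?G \<noteq> {}"
    using assms by (auto simp: sites_def)
  from symmetric_group_mean_deviation[OF finite_sites this less_imp_le[OF cw_factor_pos]]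
  have "(\<Sum>A\<in>Pow (sites n). cw_factor \<beta> ?N (card A) *
      ((\<Sum>i=1..n \<kappa>. spin A (\<kappa>, i)) / n \<kappa> - (\<Sum>p\<in>sites n. spin A p) / ?N)\<^sup>2)
    \<le> 2 / n \<kappa> * (\<Sum>A\<in>Pow (sites n). cw_factor \<beta> ?N (card A))"
    by (simp only: G card)
  moreover have "(\<Sum>A\<in>Pow (sites n). cw_factor \<beta> ?N (card A) *
      ((\<Sum>i=1..n \<kappa>. spin A (\<kappa>, i)) / n \<kappa> - (\<Sum>p\<in>sites n. spin A p) / ?N)\<^sup>2)
    = (\<Sum>A\<in>Pow (sites n). cw_factor \<beta> ?N (card A) *
      (spin_means n A $ \<kappa> - (2 * real (card A) - real ?N) / real ?N)\<^sup>2)"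
    by (intro sum.cong refl) (auto simp: sum_spin spin_means_def)
  ultimately show ?thesis
    unfolding cw_expectation_def using cw_normalization_pos[of \<beta> n] by (simp add: pos_divide_le_eq)
qed

section \<open>Passage from random variables to finite sums\<close>

lemma (in curie_weiss) group_means_measurable: "group_means n X \<in> borel_measurable P"
  unfolding borel_measurable_euclidean_space[of "group_means n X"]
  by (auto simp: Basis_vec_def inner_axis group_means_def
      intro!: borel_measurable_divide borel_measurable_sum spin_measurable)

text \<open>The events that fix all spins partition the space into finitely many pieces on which the
  integrand is constant, so the joint law turns the integral into a weighted sum over
  configurations.\<close>

lemma (in curie_weiss) integral_group_means:
  assumes "homogeneous_coupling J \<beta>"
  shows "(\<integral>\<omega>. h (group_means n X \<omega>) \<partial>P) = cw_expectation \<beta> n (\<lambda>A. h (spin_means n A))"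
proof -
  define E where "E x = {\<omega> \<in> space P. \<forall>\<kappa>. \<forall>i\<in>{1..n \<kappa>}. X \<kappa> i \<omega> = x \<kappa> i}" for x
  define v where "v x = h (\<chi> \<kappa>. (\<Sum>i=1..n \<kappa>. x \<kappa> i) / real (n \<kappa>))" for x
  have fin: "finite (spin_configs n)"
    unfolding spin_configs_def by (intro finite_PiE) auto
  have meas: "E x \<in> sets P" for x
  proof -
    have "E x = space P \<inter> (\<Inter>p\<in>sites n. {\<omega> \<in> space P. X (fst p) (snd p) \<omega> = x (fst p) (snd p)})"
      by (auto simp: E_def sites_def)
    also have "\<dots> \<in> sets P"
    \<comment> \<open>\<open>sets.finite_INT\<close> requires a nonempty index set; without sites
      the event is all of \<open>space P\<close>.\<close>
    proof (cases "sites n = {}")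
      case False
      have "{\<omega> \<in> space P. X (fst p) (snd p) \<omega> = x (fst p) (snd p)} \<in> sets P" if "p \<in> sites n" for p
        using that by (intro borel_measurable_eq spin_measurable) (auto simp: sites_def)
      then show ?thesis
        using False by (intro sets.Int sets.finite_INT) auto
    qed simp
    finally show ?thesis .
  qed
  have split: "h (group_means n X \<omega>) = (\<Sum>x\<in>spin_configs n. v x * indicator (E x) \<omega>)"
    if "\<omega> \<in> space P" for \<omega>
  proof -
    \<comment> \<open>Restricting the observed spins to the index sets gives an extensional
      function, hence the only configuration whose event contains \<omega>.\<close>
    define y where "y = (\<lambda>\<kappa>. \<lambda>i\<in>{1..n \<kappa>}. X \<kappa> i \<omega>)"
    have y: "y \<in> spin_configs n"
      using spin_values that by (auto simp: y_def spin_configs_def PiE_iff)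
    have "\<omega> \<in> E x \<longleftrightarrow> x = y" if "x \<in> spin_configs n" for x
    proof
      assume "\<omega> \<in> E x"
      show "x = y"
      proof
        fix \<kappa>
        have "x \<kappa> \<in> extensional {1..n \<kappa>}"
          using that by (auto simp: spin_configs_def PiE_iff)
        then show "x \<kappa> = y \<kappa>"
          using \<open>\<omega> \<in> E x\<close> by (intro extensionalityI) (auto simp: E_def y_def)
      qed
    qed (use \<open>\<omega> \<in> space P\<close> in \<open>auto simp: E_def y_def\<close>)
    then have "(\<Sum>x\<in>spin_configs n. v x * indicator (E x) \<omega>) = (\<Sum>x\<in>spin_configs n. if x = y then v y else 0)"
      by (intro sum.cong) (auto simp: indicator_def)
    also have "\<dots> = v y"
      using fin y by simp
    finally show ?thesis
      by (simp add: v_def y_def group_means_def)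
  qed
  have "(\<integral>\<omega>. h (group_means n X \<omega>) \<partial>P) = (\<integral>\<omega>. (\<Sum>x\<in>spin_configs n. v x * indicator (E x) \<omega>) \<partial>P)"
    by (intro Bochner_Integration.integral_cong refl split)
  also have "\<dots> = (\<Sum>x\<in>spin_configs n. v x * measure P (E x))"
    using meas sets.sets_into_space
    by (subst Bochner_Integration.integral_sum) (auto simp: Int_absorb2 emeasure_eq_measure)
  also have "\<dots> = (\<Sum>x\<in>spin_configs n. gibbs_weight J n x * v x) / partition_function J n"
    using joint_law by (simp add: E_def sum_divide_distrib mult.commute)
  also have "\<dots> = cw_expectation \<beta> n (\<lambda>A. v (spin_config n A))"
    unfolding cw_expectation_def partition_function_def
      sum.reindex_bij_betw[OF bij_betw_spin_config, symmetric]
    using assms by (simp add: gibbs_weight_spin_config)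
  also have "(\<lambda>A. v (spin_config n A)) = (\<lambda>A. h (spin_means n A))"
    by (simp add: v_def spin_config_def spin_means_def)
  finally show ?thesis .
qed

text \<open>The measure is the image of a fair coin, for which the integral is a two-term
  sum.\<close>

lemma integral_two_point_measure:
  fixes f :: "'b::topological_space \<Rightarrow> real"
  assumes [measurable]: "f \<in> borel_measurable borel"
  shows "(\<integral>z. f z \<partial>two_point_measure x y) = (f x + f y) / 2"
proof -
  let ?b = "measure_pmf (bernoulli_pmf (1/2))" and ?g = "\<lambda>b. if b then x else y"
  have "two_point_measure x y = distr ?b borel ?g"
  proof (rule measure_eqI)
    fix A assume "A \<in> sets (two_point_measure x y)"
    then have A: "A \<in> sets borel" by simp
    have "emeasure (distr ?b borel ?g) A = (\<integral>\<^sup>+b. indicator A (?g b) \<partial>?b)"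
      using A by (subst nn_integral_indicator[symmetric], simp, subst nn_integral_distr) auto
    also have "\<dots> = 1/2 * (indicator A x + indicator A y)"
      by (simp add: distrib_left mult.commute ennreal_divide_times divide_ennreal_def)
    finally show "emeasure (two_point_measure x y) A = emeasure (distr ?b borel ?g) A"
      using A by (simp add: emeasure_two_point_measure)
  qed simp
  then show ?thesis
    by (simp add: integral_distr add_divide_distrib)
qed


text \<open>Chebyshev's inequality enters through the pointwise bound
  \<open>of_bool (\<delta> < \<bar>v - s\<bar>) \<le> (v - s)\<^sup>2 / \<delta>\<^sup>2\<close>.\<close>

lemma cw_expectation_two_point_bound:
  fixes \<beta> :: real and f :: "real ^ 'm::finite \<Rightarrow> real" and n :: "'m \<Rightarrow> nat"
  defines "a \<equiv> \<chi> \<kappa>. magnetization \<beta>"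
  assumes bounded: "\<And>x. \<bar>f x\<bar> \<le> B"
    and \<delta>: "0 < \<delta>"
    and near: "\<And>x. (\<And>\<kappa>. \<bar>x $ \<kappa> - magnetization \<beta>\<bar> \<le> 2 * \<delta>) \<Longrightarrow> \<bar>(f x + f (- x)) - (f a + f (- a))\<bar> \<le> 2 * \<eta>"
    and n: "\<And>\<kappa>. 0 < n \<kappa>"
    and N: "card (sites n) = N"
  shows "\<bar>cw_expectation \<beta> n (\<lambda>A. f (spin_means n A)) - (f a + f (- a)) / 2\<bar>
    \<le> \<eta> + 2 * B * ((\<Sum>k | k \<le> N \<and> \<delta> < \<bar>\<bar>2 * real k - real N\<bar> / real N - magnetization \<beta>\<bar>. cw_mass \<beta> N k)
          / (\<Sum>k\<le>N. cw_mass \<beta> N k) + (\<Sum>\<kappa>\<in>UNIV. 2 / real (n \<kappa>) / \<delta>\<^sup>2))"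
proof -
  define m where "m = magnetization \<beta>"
  \<comment> \<open>Averaging \<open>f\<close> with its reflection merges the two limit points:
    \<open>g\<close> is even and vanishes at \<open>a\<close> and \<open>- a\<close>.\<close>
  define g where "g x = ((f x + f (- x)) - (f a + f (- a))) / 2" for x
  define s where "s A = (2 * real (card A) - real N) / real N" for A :: "('m \<times> nat) set"
  define bad where "bad k \<longleftrightarrow> \<delta> < \<bar>\<bar>2 * real k - real N\<bar> / real N - m\<bar>" for k
  have B: "0 \<le> B"
    using bounded[of 0] by simp
  have g_le: "\<bar>g x\<bar> \<le> 2 * B" for x
    using bounded[of x] bounded[of "- x"] bounded[of a] bounded[of "- a"] by (simp add: g_def)
  have g_even: "g (- x) = g x" for x
    by (simp add: g_def)
  have g_near: "\<bar>g x\<bar> \<le> \<eta>" if "\<And>\<kappa>. \<bar>x $ \<kappa> - m\<bar> \<le> 2 * \<delta>" for x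
    using near[of x] that by (simp add: g_def m_def)
  have \<eta>: "0 \<le> \<eta>"
    using g_near[of a] \<delta> by (simp add: a_def m_def g_def)
  define D where "D A \<kappa> = (spin_means n A $ \<kappa> - s A)\<^sup>2" for A \<kappa>
  have pointwise: "\<bar>g (spin_means n A)\<bar>
      \<le> \<eta> + 2 * B * (of_bool (bad (card A)) + (\<Sum>\<kappa>\<in>UNIV. 1 / \<delta>\<^sup>2 * D A \<kappa>))" for A
  proof -
    have D: "0 \<le> 1 / \<delta>\<^sup>2 * D A \<kappa>" for \<kappa>
      by (simp add: D_def)
    then have sum_D: "0 \<le> (\<Sum>\<kappa>\<in>UNIV. 1 / \<delta>\<^sup>2 * D A \<kappa>)"
      by (intro sum_nonneg)
    \<comment> \<open>Either the total magnetization is off, or some group strays from it, or every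
      group mean lies within \<open>2 * \<delta>\<close> of the same limit point. In the first two
      cases the trivial bound \<open>2 * B\<close> on \<open>g\<close> is paid.\<close>
    consider "bad (card A)" | \<kappa> where "\<delta> < \<bar>spin_means n A $ \<kappa> - s A\<bar>"
      | "\<not> bad (card A)" "\<And>\<kappa>. \<bar>spin_means n A $ \<kappa> - s A\<bar> \<le> \<delta>"
      by (meson not_le)
    then show ?thesis
    proof cases
      case 3
      have s: "\<bar>\<bar>s A\<bar> - m\<bar> \<le> \<delta>"
        using 3(1) by (simp add: bad_def s_def)
      have "\<bar>g (spin_means n A)\<bar> \<le> \<eta>"
      proof (cases "0 \<le> s A")
        case True
        then have "\<bar>spin_means n A $ \<kappa> - m\<bar> \<le> 2 * \<delta>" for \<kappa>
          using s 3(2)[of \<kappa>] by linarith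
        then show ?thesis by (rule g_near)
      next
        case False
        \<comment> \<open>A negative total puts the means near \<open>- a\<close>; \<open>g\<close>
          is even, so the negated means may be used.\<close>
        then have "\<bar>(- spin_means n A) $ \<kappa> - m\<bar> \<le> 2 * \<delta>" for \<kappa>
          using s 3(2)[of \<kappa>] unfolding vector_uminus_component by linarith
        then have "\<bar>g (- spin_means n A)\<bar> \<le> \<eta>" by (rule g_near)
        then show ?thesis by (simp add: g_even)
      qed
      moreover have "0 \<le> 2 * B * (of_bool (bad (card A)) + (\<Sum>\<kappa>\<in>UNIV. 1 / \<delta>\<^sup>2 * D A \<kappa>))"
        using B sum_D by (intro mult_nonneg_nonneg add_nonneg_nonneg) auto
      ultimately show ?thesis by linarith
    next
      case 1
      have "2 * B * 1 \<le> 2 * B * (of_bool (bad (card A)) + (\<Sum>\<kappa>\<in>UNIV. 1 / \<delta>\<^sup>2 * D A \<kappa>))"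
        using B sum_D 1 by (intro mult_left_mono) auto
      then show ?thesis
        using g_le[of "spin_means n A"] \<eta> by linarith
    next
      case (2 \<kappa>)
      then have "\<delta>\<^sup>2 \<le> D A \<kappa>"
        unfolding D_def using \<delta> by (subst abs_le_square_iff[symmetric]) auto
      then have "1 \<le> 1 / \<delta>\<^sup>2 * D A \<kappa>"
        using \<delta> by (simp add: field_simps)
      also have "\<dots> \<le> (\<Sum>\<kappa>\<in>UNIV. 1 / \<delta>\<^sup>2 * D A \<kappa>)"
        using D by (intro member_le_sum) auto
      finally have "2 * B * 1 \<le> 2 * B * (of_bool (bad (card A)) + (\<Sum>\<kappa>\<in>UNIV. 1 / \<delta>\<^sup>2 * D A \<kappa>))"
        using B by (intro mult_left_mono add_increasing) auto
      then show ?thesis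
        using g_le[of "spin_means n A"] \<eta> by linarith
    qed
  qed
  \<comment> \<open>By the spin flip, symmetrising \<open>f\<close> does not change its expectation,
    so the mean of \<open>g\<close> is the quantity to be estimated.\<close>
  have "cw_expectation \<beta> n (\<lambda>A. g (spin_means n A))
      = cw_expectation \<beta> n (\<lambda>A. 1/2 * f (spin_means n A) + (1/2 * f (- spin_means n A) + - (f a + f (- a)) / 2))"
    by (simp add: g_def field_simps)
  also have "\<dots> = cw_expectation \<beta> n (\<lambda>A. f (spin_means n A)) - (f a + f (- a)) / 2"
    unfolding cw_expectation_add cw_expectation_cmult cw_expectation_const
    using cw_expectation_spin_flip[of \<beta> n f] by (simp add: field_simps)
  finally have "\<bar>cw_expectation \<beta> n (\<lambda>A. f (spin_means n A)) - (f a + f (- a)) / 2\<bar>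
      \<le> cw_expectation \<beta> n (\<lambda>A. \<bar>g (spin_means n A)\<bar>)"
    using abs_cw_expectation_le[of \<beta> n "\<lambda>A. g (spin_means n A)"] by simp
  also have "\<dots> \<le> cw_expectation \<beta> n
      (\<lambda>A. \<eta> + 2 * B * (of_bool (bad (card A)) + (\<Sum>\<kappa>\<in>UNIV. 1 / \<delta>\<^sup>2 * D A \<kappa>)))"
    by (intro cw_expectation_mono pointwise)
  also have "\<dots> = \<eta> + 2 * B * (cw_expectation \<beta> n (\<lambda>A. of_bool (bad (card A)))
      + (\<Sum>\<kappa>\<in>UNIV. 1 / \<delta>\<^sup>2 * cw_expectation \<beta> n (\<lambda>A. D A \<kappa>)))"
    unfolding cw_expectation_add cw_expectation_cmult cw_expectation_const cw_expectation_sum ..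
  also have "\<dots> \<le> \<eta> + 2 * B * (cw_expectation \<beta> n (\<lambda>A. of_bool (bad (card A)))
      + (\<Sum>\<kappa>\<in>UNIV. 1 / \<delta>\<^sup>2 * (2 / real (n \<kappa>))))"
    using B cw_expectation_group_deviation[OF n, of \<beta>] N unfolding D_def s_def
    by (intro add_left_mono mult_left_mono sum_mono) auto
  finally show ?thesis
    unfolding cw_expectation_of_bool_card[where Q = bad] unfolding bad_def N m_def
    by (simp add: mult.commute)
qed

section \<open>Weak convergence of the vector of group means\<close>

theorem theorem21:
  fixes \<beta> :: real
    and J :: "real ^ 'm::finite ^ 'm"
    and \<alpha> :: "'m \<Rightarrow> real"
    and n :: "nat \<Rightarrow> 'm \<Rightarrow> nat"
    and P :: "nat \<Rightarrow> 'a measure"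
    and X :: "nat \<Rightarrow> 'm \<Rightarrow> nat \<Rightarrow> 'a \<Rightarrow> real"
  assumes "\<beta> \<ge> 0"
    and "homogeneous_coupling J \<beta>"
    and "\<And>N. (\<Sum>\<kappa>\<in>UNIV. n N \<kappa>) = N"
    and "\<And>\<kappa>. filterlim (\<lambda>N. n N \<kappa>) at_top sequentially"
    and "\<And>\<kappa>. (\<lambda>N. real (n N \<kappa>) / real N) \<longlonglongrightarrow> \<alpha> \<kappa>"
    and "\<And>\<kappa>. \<alpha> \<kappa> \<ge> 0"
    and "(\<Sum>\<kappa>\<in>UNIV. \<alpha> \<kappa>) = 1"
    and "\<And>N. curie_weiss (P N) J (n N) (X N)"
  shows "weakly_converges
           (\<lambda>N. distr (P N) borel (group_means (n N) (X N)))
           (two_point_measure (\<chi> \<kappa>. - magnetization \<beta>) (\<chi> \<kappa>. magnetization \<beta>))"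
  unfolding weakly_converges_def
proof (intro allI impI)
  fix f :: "real ^ 'm \<Rightarrow> real"
  assume cont: "continuous_on UNIV f" and bdd: "bounded (range f)"
  have [measurable]: "f \<in> borel_measurable borel"
    using cont by (rule borel_measurable_continuous_onI)
  define a :: "real ^ 'm" where "a = (\<chi> \<kappa>. magnetization \<beta>)"
  define M where "M = real CARD('m)"
  have M: "0 < M"
    by (simp add: M_def)
  have minus_a: "(\<chi> \<kappa>. - magnetization \<beta>) = - a"
    by (simp add: a_def vec_eq_iff)
  obtain B where B: "\<And>x. \<bar>f x\<bar> \<le> B"
    using bdd by (auto simp: bounded_iff)
  have "(\<integral>x. f x \<partial>distr (P N) borel (group_means (n N) (X N)))
      = cw_expectation \<beta> (n N) (\<lambda>A. f (spin_means (n N) A))" for N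
  proof -
    interpret curie_weiss "P N" J "n N" "X N"
      by fact
    show ?thesis
      using integral_group_means[OF assms(2), of f] group_means_measurable
      by (simp add: integral_distr)
  qed
  moreover have "(\<lambda>N. cw_expectation \<beta> (n N) (\<lambda>A. f (spin_means (n N) A))) \<longlonglongrightarrow> (f a + f (- a)) / 2"
  proof (rule tendstoI)
    fix e :: real assume "0 < e"
    define h where "h x = f x + f (- x)" for x
    have "continuous_on UNIV h"
      unfolding h_def using cont
      by (intro continuous_intros continuous_on_compose2[OF cont]) auto
    then obtain d where d: "0 < d" "\<And>x. dist x a < d \<Longrightarrow> dist (h x) (h a) < e"
      using \<open>0 < e\<close> unfolding continuous_on_iff by (metis UNIV_I)
    \<comment> \<open>There are \<open>M\<close> coordinates, each off by at most
      \<open>2 * \<delta>\<close>, so the l1 bound on the norm gives \<open>d / 2\<close>, below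
      \<open>d\<close>.\<close>
    define \<delta> where "\<delta> = d / (4 * M)"
    have \<delta>: "0 < \<delta>"
      using d(1) M by (simp add: \<delta>_def)
    have near: "\<bar>(f x + f (- x)) - (f a + f (- a))\<bar> \<le> 2 * (e / 2)"
      if x: "\<And>\<kappa>. \<bar>x $ \<kappa> - magnetization \<beta>\<bar> \<le> 2 * \<delta>" for x
    proof -
      have "norm (x - a) \<le> (\<Sum>\<kappa>\<in>UNIV. \<bar>(x - a) $ \<kappa>\<bar>)"
        by (rule norm_le_l1_cart)
      also have "\<dots> \<le> (\<Sum>\<kappa>\<in>(UNIV::'m set). 2 * \<delta>)"
        using x by (intro sum_mono) (simp add: a_def)
      also have "\<dots> < d"
        using d(1) M by (simp add: \<delta>_def flip: M_def)
      finally show ?thesis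
        using d(2)[of x] by (simp add: h_def dist_norm)
    qed
    \<comment> \<open>Everything but \<open>e / 2\<close> tends to 0: the first fraction by
      concentration, the sum because every group size tends to infinity.\<close>
    define R where "R N = e / 2 + 2 * B *
      ((\<Sum>k | k \<le> N \<and> \<delta> < \<bar>\<bar>2 * real k - real N\<bar> / real N - magnetization \<beta>\<bar>. cw_mass \<beta> N k)
          / (\<Sum>k\<le>N. cw_mass \<beta> N k) + (\<Sum>\<kappa>\<in>UNIV. 2 / real (n N \<kappa>) / \<delta>\<^sup>2))" for N
    have "(\<lambda>N. 2 / real (n N \<kappa>)) \<longlonglongrightarrow> 0" for \<kappa>
      by (intro real_tendsto_divide_at_top[where c = 2] filterlim_compose[OF filterlim_real_sequentially assms(4)]
          tendsto_const)
    then have "R \<longlonglongrightarrow> e / 2 + 2 * B * (0 + (\<Sum>\<kappa>\<in>(UNIV::'m set). 0 / \<delta>\<^sup>2))"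
      unfolding R_def using \<delta>
      by (intro tendsto_intros cw_mass_concentration[OF assms(1) \<delta>]) auto
    then have "\<forall>\<^sub>F N in sequentially. R N < e"
      by (rule order_tendstoD) (use \<open>0 < e\<close> in simp)
    \<comment> \<open>The deviation bound needs nonempty groups, which for small \<open>N\<close>
      may fail.\<close>
    moreover have "\<forall>\<^sub>F N in sequentially. \<forall>\<kappa>. 0 < n N \<kappa>"
      by (intro eventually_all_finite eventually_compose_filterlim[OF eventually_gt_at_top assms(4)])
    ultimately show "\<forall>\<^sub>F N in sequentially.
       dist (cw_expectation \<beta> (n N) (\<lambda>A. f (spin_means (n N) A))) ((f a + f (- a)) / 2) < e"
    proof eventually_elim
      case (elim N)
      have "card (sites (n N)) = N"
        by (simp add: card_sites assms(3))
      from cw_expectation_two_point_bound[OF B \<delta> near[unfolded a_def] _ this] elim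
      show ?case
        by (simp add: R_def dist_real_def a_def)
    qed
  qed
  ultimately show "(\<lambda>N. \<integral>x. f x \<partial>distr (P N) borel (group_means (n N) (X N)))
      \<longlonglongrightarrow> (\<integral>x. f x \<partial>two_point_measure (\<chi> \<kappa>. - magnetization \<beta>) (\<chi> \<kappa>. magnetization \<beta>))"
    by (simp add: integral_two_point_measure minus_a add.commute flip: a_def)
qed

end
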